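(* There is an absolute constant $c>0$ such that for all integers $K\ge 2$ and $V\ge 1$ and all sufficiently large $T$ (depending on $K$ and $V$), the following holds: for every algorithm for the dark pool problem with continuous-valued allocations, the adversary can choose volumes and maximum consumption levels over $T$ rounds such that the regret $R_T$ of the algorithm (in expectation, if the algorithm is randomized) is at least $c\,V\sqrt{T\ln K}$. That is, the optimal regret for the dark pool problem with continuous allocations is $\Omega(V\sqrt{T\ln K})$.
   Context: Dark pool problem with continuous allocations. There are $K$ venues. In each round $t=1,\dots,T$ the learner observes a volume $V^t\in\{1,\dots,V\}$ and chooses allocations $v_i^t\ge 0$ ($i=1,\dots,K$) with $\sum_{i=1}^K v_i^t\le V^t$. Venue $i$ has a maximum consumption level $s_i^t\ge 0$, and the learner receives (and observes only) the consumed amounts $r_i^t=\min(v_i^t,s_i^t)$. The volumes and consumption levels are chosen by an adversary. An algorithm chooses its allocations in round $t$ as a function of the volumes observed so far (including $V^t$), its past allocations and the past observed consumed amounts (and possibly internal randomness). The regret is $$R_T=\max_{\mathrm{opt}\in\{1,\dots,K\}^V}\sum_{t=1}^T\sum_{i=1}^K\left[\min(u_i^t,s_i^t)-\min(v_i^t,s_i^t)\right],\qquad u_i^t=\sum_{v=1}^{V^t}\mathbf 1(\mathrm{opt}_v=i),$$ i.e. the comparator always allocates the $v$th unit to the fixed venue $\mathrm{opt}_v$. *)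

theory Defs
  imports "HOL-Probability.Probability"
begin

text \<open>
  Venues are \<open>1, \<dots>, K\<close> and rounds are \<open>1, \<dots>, T\<close>; a vector indexed by the venues is a function
  \<open>nat \<Rightarrow> real\<close> of which only the values on \<open>{1..K}\<close> matter.
\<close>

type_synonym alloc = "nat \<Rightarrow> real"

text \<open>
  A deterministic algorithm maps the volumes of rounds \<open>1, \<dots>, t\<close>, its allocations in rounds
  \<open>1, \<dots>, t - 1\<close> and the amounts consumed in those rounds (each listed chronologically) to the
  allocation of round \<open>t\<close>.
\<close>

type_synonym algorithm = "nat list \<Rightarrow> alloc list \<Rightarrow> alloc list \<Rightarrow> alloc"

definition adversary_choice :: "nat \<Rightarrow> nat \<Rightarrow> nat \<Rightarrow> (nat \<Rightarrow> nat) \<Rightarrow> (nat \<Rightarrow> nat \<Rightarrow> real) \<Rightarrow> bool" where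
  "adversary_choice K V T vol s \<longleftrightarrow>
     (\<forall>t\<in>{1..T}. vol t \<in> {1..V} \<and> (\<forall>i\<in>{1..K}. 0 \<le> s t i))"

text \<open>
  The restriction to \<open>{1..K}\<close> ensures that the feedback carries no information beyond the amounts
  consumed at the \<open>K\<close> venues.
\<close>

definition consumed :: "nat \<Rightarrow> alloc \<Rightarrow> (nat \<Rightarrow> real) \<Rightarrow> alloc" where
  "consumed K v s = (\<lambda>i\<in>{1..K}. min (v i) (s i))"

fun allocation ::
  "nat \<Rightarrow> algorithm \<Rightarrow> (nat \<Rightarrow> nat) \<Rightarrow> (nat \<Rightarrow> nat \<Rightarrow> real) \<Rightarrow> nat \<Rightarrow> alloc" where
  "allocation K A vol s t =
     A (map vol [1..<Suc t])
       (map (\<lambda>\<tau>. allocation K A vol s \<tau>) [1..<t])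
       (map (\<lambda>\<tau>. consumed K (allocation K A vol s \<tau>) (s \<tau>)) [1..<t])"

declare allocation.simps [simp del]

definition feasible_algorithm :: "nat \<Rightarrow> nat \<Rightarrow> nat \<Rightarrow> algorithm \<Rightarrow> bool" where
  "feasible_algorithm K V T A \<longleftrightarrow>
     (\<forall>vol s. adversary_choice K V T vol s \<longrightarrow>
        (\<forall>t\<in>{1..T}. (\<forall>i\<in>{1..K}. 0 \<le> allocation K A vol s t i) \<and>
                     (\<Sum>i=1..K. allocation K A vol s t i) \<le> real (vol t)))"

text \<open>
  A randomized algorithm is a random deterministic algorithm, that is, a probability measure
  \<open>\<mu>\<close> on deterministic algorithms.  No generality is lost: an algorithm using a random seed
  \<open>\<omega>\<close> from an arbitrary probability space is represented by the image measure under the map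
  from \<open>\<omega>\<close> to the deterministic algorithm it determines.  The sigma-algebra of \<open>\<mu>\<close> is
  arbitrary, except that the realized allocations have to be random variables.
\<close>

definition randomized_algorithm :: "nat \<Rightarrow> nat \<Rightarrow> nat \<Rightarrow> algorithm measure \<Rightarrow> bool" where
  "randomized_algorithm K V T \<mu> \<longleftrightarrow>
     prob_space \<mu> \<and>
     (\<forall>A\<in>space \<mu>. feasible_algorithm K V T A) \<and>
     (\<forall>vol s. adversary_choice K V T vol s \<longrightarrow>
        (\<forall>t\<in>{1..T}. \<forall>i\<in>{1..K}. (\<lambda>A. allocation K A vol s t i) \<in> borel_measurable \<mu>))"

definition comparator :: "(nat \<Rightarrow> nat) \<Rightarrow> nat \<Rightarrow> alloc" where
  "comparator opt n i = (\<Sum>v=1..n. of_bool (opt v = i))"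

definition regret ::
  "nat \<Rightarrow> nat \<Rightarrow> nat \<Rightarrow> algorithm \<Rightarrow> (nat \<Rightarrow> nat) \<Rightarrow> (nat \<Rightarrow> nat \<Rightarrow> real) \<Rightarrow> real" where
  "regret K V T A vol s =
     (MAX opt \<in> {1..V} \<rightarrow>\<^sub>E {1..K}. \<Sum>t=1..T. \<Sum>i=1..K.
        (min (comparator opt (vol t) i) (s t i) - min (allocation K A vol s t i) (s t i)))"

definition expected_regret ::
  "nat \<Rightarrow> nat \<Rightarrow> nat \<Rightarrow> algorithm measure \<Rightarrow> (nat \<Rightarrow> nat) \<Rightarrow> (nat \<Rightarrow> nat \<Rightarrow> real) \<Rightarrow> real" where
  "expected_regret K V T \<mu> vol s = (\<integral>A. regret K V T A vol s \<partial>\<mu>)"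

text \<open>Deterministic algorithms are the point masses among the randomized ones.\<close>

lemma randomized_algorithm_return:
  assumes "feasible_algorithm K V T A"
  shows "randomized_algorithm K V T (return (count_space {A}) A)"
  using assms unfolding randomized_algorithm_def
  by (auto intro!: prob_space_return simp: space_return cong: measurable_cong_sets)

lemma expected_regret_return:
  "expected_regret K V T (return (count_space {A}) A) vol s = regret K V T A vol s"
  unfolding expected_regret_def by (subst integral_return) auto

end

theory Submission
  imports Defs "HOL-Library.Discrete_Functions"
begin

text \<open>
  Every round has volume \<open>V\<close> and draws one fair sign \<open>e\<^sub>t\<close>. With \<open>m = \<lfloor>log\<^sub>2 K\<rfloor>\<close>, the rounds are
  split into \<open>m\<close> classes modulo \<open>m\<close>, and in a round of class \<open>j\<close> venue \<open>i\<close> consumes up to \<open>V\<close> if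
  the truth value of \<open>e\<^sub>t = 1\<close> is bit \<open>j\<close> of \<open>i - 1\<close>, and nothing otherwise. Given the past, each
  venue is a fair coin, so the learner collects at most \<open>V / 2\<close> per round on average. In hindsight the bits of the best
  single venue can be matched to the signs of the \<open>m\<close> class sums \<open>S\<^sub>j\<close> of the \<open>e\<^sub>t\<close>, which yields
  \<open>V / 2 * (T + (\<Sum>j<m. \<bar>S\<^sub>j\<bar>))\<close>. By Khintchine's inequality each \<open>\<bar>S\<^sub>j\<bar>\<close> is of order \<open>sqrt (T / m)\<close> on
  average, so the regret is of order \<open>V * m * sqrt (T / m) = V * sqrt (T * m)\<close>.
\<close>

section \<open>Khintchine's inequality\<close>

text \<open>A sign vector is encoded as the set \<open>X\<close> of indices carrying +1, so an
  expectation over independent fair signs becomes an average over \<open>Pow N\<close>.\<close>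

definition sign_in :: "'a set \<Rightarrow> 'a \<Rightarrow> real" where
  "sign_in X t = (if t \<in> X then 1 else - 1)"

lemma sum_Pow_insert:
  fixes f :: "'a set \<Rightarrow> real"
  assumes "finite F" "x \<notin> F"
  shows "(\<Sum>X\<in>Pow (insert x F). f X) = (\<Sum>X\<in>Pow F. f X + f (insert x X))"
proof -
  have "inj_on (insert x) (Pow F)"
    using assms(2) by (force simp: inj_on_def)
  moreover have "Pow F \<inter> insert x ` Pow F = {}"
    using assms(2) by auto
  ultimately show ?thesis
    using assms(1) by (simp add: Pow_insert sum.union_disjoint sum.reindex sum.distrib)
qed

text \<open>Conditioning on all signs but that of \<open>x\<close>; this is the induction step for
  both moment computations.\<close>

lemma sum_Pow_insert_sign:
  fixes c :: "'a \<Rightarrow> real" and g :: "real \<Rightarrow> real"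
  assumes "finite F" "x \<notin> F"
  shows "(\<Sum>X\<in>Pow (insert x F). g (\<Sum>t\<in>insert x F. c t * sign_in X t)) =
    (\<Sum>X\<in>Pow F. g ((\<Sum>t\<in>F. c t * sign_in X t) - c x) + g ((\<Sum>t\<in>F. c t * sign_in X t) + c x))"
proof -
  have "(\<Sum>t\<in>F. c t * sign_in (insert x X) t) = (\<Sum>t\<in>F. c t * sign_in X t)" for X
    using assms(2) by (intro sum.cong) (auto simp: sign_in_def)
  moreover have "sign_in X x = -1" if "X \<in> Pow F" for X
    using that assms(2) by (auto simp: sign_in_def)
  moreover have "sign_in (insert x X) x = 1" for X
    by (simp add: sign_in_def)
  ultimately show ?thesis
    using assms by (subst sum_Pow_insert) (auto intro!: sum.cong simp: algebra_simps)
qed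

lemma sum_Pow_signs_power2:
  fixes c :: "'a \<Rightarrow> real"
  assumes "finite N"
  shows "(\<Sum>X\<in>Pow N. (\<Sum>t\<in>N. c t * sign_in X t)\<^sup>2) = 2 ^ card N * (\<Sum>t\<in>N. (c t)\<^sup>2)"
  using assms
proof induction
  case empty
  then show ?case by simp
next
  case (insert x F)
  have "(a - c x)\<^sup>2 + (a + c x)\<^sup>2 = 2 * a\<^sup>2 + 2 * (c x)\<^sup>2" for a
    by (simp add: power2_eq_square algebra_simps)
  then show ?case
    using insert unfolding sum_Pow_insert_sign[OF insert.hyps, where g = "\<lambda>y. y\<^sup>2"]
    by (simp add: sum.distrib card_Pow distrib_left flip: sum_distrib_left)
qed

text \<open>Averaging over the sign of \<open>x\<close> cancels its odd powers and leaves the second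
  moment as the only mixed term, so the induction closes with constant 3, the Gaussian
  value.\<close>

lemma sum_Pow_signs_power4:
  fixes c :: "'a \<Rightarrow> real"
  assumes "finite N"
  shows "(\<Sum>X\<in>Pow N. (\<Sum>t\<in>N. c t * sign_in X t) ^ 4) \<le> 2 ^ card N * (3 * (\<Sum>t\<in>N. (c t)\<^sup>2)\<^sup>2)"
  using assms
proof induction
  case empty
  then show ?case by simp
next
  case (insert x F)
  let ?S = "\<lambda>X. \<Sum>t\<in>F. c t * sign_in X t" and ?Q = "\<Sum>t\<in>F. (c t)\<^sup>2"
  have expand: "(a - c x) ^ 4 + (a + c x) ^ 4 = 2 * a ^ 4 + 12 * (c x)\<^sup>2 * a\<^sup>2 + 2 * (c x) ^ 4" for a
    by (simp add: power2_eq_square power4_eq_xxxx algebra_simps)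
  have "(\<Sum>X\<in>Pow (insert x F). (\<Sum>t\<in>insert x F. c t * sign_in X t) ^ 4) =
      2 * (\<Sum>X\<in>Pow F. ?S X ^ 4) + 12 * (c x)\<^sup>2 * (\<Sum>X\<in>Pow F. (?S X)\<^sup>2) + 2 ^ card F * (2 * (c x) ^ 4)"
    using insert.hyps unfolding sum_Pow_insert_sign[OF insert.hyps, where g = "\<lambda>y. y ^ 4"]
    by (simp add: expand sum.distrib card_Pow flip: sum_distrib_left)
  \<comment> \<open>The coefficient of \<open>(c x) ^ 4\<close> is raised from 2 to 6 to complete
    the square of \<open>?Q + (c x)\<^sup>2\<close>.\<close>
  also have "\<dots> \<le> 2 * (2 ^ card F * (3 * ?Q\<^sup>2)) + 12 * (c x)\<^sup>2 * (2 ^ card F * ?Q) + 2 ^ card F * (6 * (c x) ^ 4)"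
    using insert.IH by (intro add_mono mult_left_mono)
      (auto simp: sum_Pow_signs_power2[OF insert.hyps(1)])
  also have "\<dots> = 2 ^ card (insert x F) * (3 * (\<Sum>t\<in>insert x F. (c t)\<^sup>2)\<^sup>2)"
    using insert.hyps by (simp add: power2_eq_square power4_eq_xxxx algebra_simps)
  finally show ?case .
qed

lemma khintchine_lower_bound:
  fixes c :: "'a \<Rightarrow> real"
  assumes "finite N"
  shows "2 ^ card N * sqrt ((\<Sum>t\<in>N. (c t)\<^sup>2) / 3) \<le> (\<Sum>X\<in>Pow N. \<bar>\<Sum>t\<in>N. c t * sign_in X t\<bar>)"
proof -
  define Q where "Q = (\<Sum>t\<in>N. (c t)\<^sup>2)"
  define S where "S X = (\<Sum>t\<in>N. c t * sign_in X t)" for X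
  show ?thesis
  proof (cases "Q = 0")
    case True
    then show ?thesis by (simp add: Q_def sum_nonneg)
  next
    case False
    \<comment> \<open>This scale maximizes the lower bound
      \<open>(3 * Q / l - 3 * Q\<^sup>2 / l ^ 3) / 2\<close> that the two moments give for the mean
      of \<bar>S\<bar>.\<close>
    define l where "l = sqrt (3 * Q)"
    have Q: "Q > 0"
      using False by (simp add: Q_def sum_nonneg order.not_eq_order_implies_strict)
    have l: "l > 0" "l\<^sup>2 = 3 * Q" using Q by (auto simp: l_def)
    have l4: "l ^ 4 = 9 * Q\<^sup>2"
      using l(2) by (simp add: power2_eq_square power4_eq_xxxx algebra_simps)
    \<comment> \<open>A pointwise lower bound on \<open>\<bar>S\<bar>\<close> by second and fourth powers, tight at \<open>y = 1\<close>.\<close>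
    have poly: "(3 * y\<^sup>2 - y ^ 4) / 2 \<le> y" if "y \<ge> 0" for y :: real
    proof -
      have "0 \<le> y * ((y - 1)\<^sup>2 * (y + 2))" using that by simp
      also have "\<dots> = 2 * y - (3 * y\<^sup>2 - y ^ 4)"
        by (simp add: power2_eq_square power4_eq_xxxx algebra_simps)
      finally show ?thesis by simp
    qed
    have pointwise: "l * (3 * ((S X)\<^sup>2 / l\<^sup>2) - S X ^ 4 / l ^ 4) / 2 \<le> \<bar>S X\<bar>" for X
      using poly[of "\<bar>S X\<bar> / l"] l(1) by (simp add: power_divide field_simps)
    have S4: "(\<Sum>X\<in>Pow N. S X ^ 4) / l ^ 4 \<le> 2 ^ card N / 3"
      using sum_Pow_signs_power4[OF assms, of c] Q
      by (simp add: S_def Q_def l4 field_simps)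
    have "sqrt (Q / 3) = l / 3"
      using l Q by (intro real_sqrt_unique) (auto simp: power_divide)
    then have "2 ^ card N * sqrt (Q / 3) = l * (3 * (2 ^ card N / 3) - 2 ^ card N / 3) / 2"
      by simp
    also have "\<dots> \<le> l * (3 * ((\<Sum>X\<in>Pow N. (S X)\<^sup>2) / l\<^sup>2) - (\<Sum>X\<in>Pow N. S X ^ 4) / l ^ 4) / 2"
      using l(1) S4 Q sum_Pow_signs_power2[OF assms, of c]
      by (intro divide_right_mono mult_left_mono diff_mono) (auto simp: l(2) S_def Q_def)
    also have "\<dots> = (\<Sum>X\<in>Pow N. l * (3 * ((S X)\<^sup>2 / l\<^sup>2) - S X ^ 4 / l ^ 4) / 2)"
      by (simp add: sum_subtractf flip: sum_divide_distrib sum_distrib_left)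
    also have "\<dots> \<le> (\<Sum>X\<in>Pow N. \<bar>S X\<bar>)"
      by (intro sum_mono pointwise)
    finally show ?thesis by (simp add: Q_def S_def)
  qed
qed

text \<open>Indicator coefficients single out \<open>B\<close> while the average still runs over all
  of \<open>N\<close>, so different classes of rounds can share one random sign vector.\<close>

lemma khintchine_lower_bound_subset:
  assumes "finite N" "B \<subseteq> N"
  shows "2 ^ card N * sqrt (card B / 3) \<le> (\<Sum>X\<in>Pow N. \<bar>\<Sum>t\<in>B. sign_in X t\<bar>)"
proof -
  have "(\<Sum>t\<in>N. of_bool (t \<in> B) * sign_in X t) = (\<Sum>t\<in>B. sign_in X t)" for X
    using assms by (intro sum.mono_neutral_cong_right) auto
  moreover have "(\<Sum>t\<in>N. (of_bool (t \<in> B) :: real)\<^sup>2) = card B"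
    using assms by (simp add: Int_absorb1 power2_eq_square flip: of_bool_conj)
  ultimately show ?thesis
    using khintchine_lower_bound[OF assms(1), of "\<lambda>t. of_bool (t \<in> B)"] by simp
qed

section \<open>Regret\<close>

text \<open>Supplies the best venue in hindsight: once \<open>2 ^ m \<le> K\<close>, every pattern
  of \<open>m\<close> bits belongs to some venue.\<close>

lemma ex_nat_with_bits: "\<exists>n::nat. n < 2 ^ m \<and> (\<forall>j<m. bit n j \<longleftrightarrow> P j)"
proof (induction m arbitrary: P)
  case 0
  then show ?case by simp
next
  case (Suc m)
  obtain n :: nat where n: "n < 2 ^ m" "\<forall>j<m. bit n j \<longleftrightarrow> P (Suc j)"
    using Suc.IH[of "\<lambda>j. P (Suc j)"] by auto
  show ?case
  proof (intro exI[of _ "of_bool (P 0) + 2 * n"] conjI allI impI)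
    show "of_bool (P 0) + 2 * n < 2 ^ Suc m" using n(1) by auto
    show "bit (of_bool (P 0) + 2 * n) j \<longleftrightarrow> P j" if "j < Suc m" for j
      using n(2) that by (cases j) (auto simp: bit_0 bit_Suc)
  qed
qed

text \<open>Causality: consumption levels reach the algorithm only through the feedback of earlier
  rounds, so an allocation cannot react to the sign of its own round.\<close>

lemma allocation_cong:
  assumes "\<And>\<tau>. \<tau> \<in> {1..t} \<Longrightarrow> vol \<tau> = vol' \<tau>"
    and "\<And>\<tau> i. \<tau> \<in> {1..<t} \<Longrightarrow> i \<in> {1..K} \<Longrightarrow> s \<tau> i = s' \<tau> i"
  shows "allocation K A vol s t = allocation K A vol' s' t"
  using assms
proof (induction t rule: less_induct)
  case (less t)
  have IH: "allocation K A vol s \<tau> = allocation K A vol' s' \<tau>" if "\<tau> \<in> {1..<t}" for \<tau>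
    using that by (intro less.IH less.prems) auto
  have "consumed K (allocation K A vol s \<tau>) (s \<tau>) = consumed K (allocation K A vol' s' \<tau>) (s' \<tau>)"
    if "\<tau> \<in> {1..<t}" for \<tau>
    unfolding consumed_def using that IH less.prems(2) by (intro restrict_ext) auto
  moreover have "map vol [1..<Suc t] = map vol' [1..<Suc t]"
    using less.prems(1) by (intro map_cong) auto
  ultimately show ?case
    unfolding allocation.simps[of _ _ _ _ t] using IH
    by (intro arg_cong3[where f = A] map_cong) auto
qed

definition comparator_reward :: "nat \<Rightarrow> nat \<Rightarrow> nat \<Rightarrow> (nat \<Rightarrow> nat) \<Rightarrow> (nat \<Rightarrow> nat \<Rightarrow> real) \<Rightarrow> real" where
  "comparator_reward K V T vol s =
     (MAX opt \<in> {1..V} \<rightarrow>\<^sub>E {1..K}. \<Sum>t=1..T. \<Sum>i=1..K. min (comparator opt (vol t) i) (s t i))"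

definition learner_reward :: "nat \<Rightarrow> nat \<Rightarrow> algorithm \<Rightarrow> (nat \<Rightarrow> nat) \<Rightarrow> (nat \<Rightarrow> nat \<Rightarrow> real) \<Rightarrow> real" where
  "learner_reward K T A vol s = (\<Sum>t=1..T. \<Sum>i=1..K. min (allocation K A vol s t i) (s t i))"

text \<open>The learner's reward does not depend on \<open>opt\<close> and leaves the maximum, so
  the two rewards can be averaged separately.\<close>

lemma regret_eq:
  assumes "K \<ge> 1"
  shows "regret K V T A vol s = comparator_reward K V T vol s - learner_reward K T A vol s"
proof -
  have fin: "finite ({1..V} \<rightarrow>\<^sub>E {1..K})" by (simp add: finite_PiE)
  have ne: "{1..V} \<rightarrow>\<^sub>E {1..K} \<noteq> {}" using assms by (simp add: PiE_eq_empty_iff)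
  have "regret K V T A vol s = (MAX opt \<in> {1..V} \<rightarrow>\<^sub>E {1..K}.
      (\<Sum>t=1..T. \<Sum>i=1..K. min (comparator opt (vol t) i) (s t i)) + - learner_reward K T A vol s)"
    unfolding regret_def learner_reward_def by (simp add: sum_subtractf)
  also have "\<dots> = comparator_reward K V T vol s - learner_reward K T A vol s"
    unfolding comparator_reward_def by (subst Max_add_commute[OF fin ne]) simp
  finally show ?thesis .
qed

text \<open>Take \<open>opt\<close> constantly \<open>i\<close>: venue \<open>i\<close> gets the
  whole volume, which covers its level, and the others get nothing and consume nothing since levels
  are nonnegative.\<close>

lemma comparator_reward_ge_single_venue:
  assumes "i \<in> {1..K}"
    and "\<And>t. t \<in> {1..T} \<Longrightarrow> vol t \<in> {1..V} \<and> s t i \<le> vol t"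
    and "\<And>t i. t \<in> {1..T} \<Longrightarrow> i \<in> {1..K} \<Longrightarrow> s t i \<ge> 0"
  shows "(\<Sum>t=1..T. s t i) \<le> comparator_reward K V T vol s"
proof -
  define opt where "opt = (\<lambda>v\<in>{1..V}. i)"
  have opt: "opt \<in> {1..V} \<rightarrow>\<^sub>E {1..K}" using assms(1) by (auto simp: opt_def)
  have comp: "comparator opt (vol t) k = (if k = i then vol t else 0)" if "t \<in> {1..T}" for t k
  proof -
    have "comparator opt (vol t) k = (\<Sum>v=1..vol t. of_bool (i = k))"
      unfolding comparator_def using assms(2)[OF that] by (intro sum.cong) (auto simp: opt_def)
    then show ?thesis by auto
  qed
  have "(\<Sum>t=1..T. s t i) = (\<Sum>t=1..T. \<Sum>k=1..K. min (comparator opt (vol t) k) (s t k))"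
  proof (intro sum.cong refl)
    fix t assume t: "t \<in> {1..T}"
    have "(\<Sum>k=1..K. min (comparator opt (vol t) k) (s t k)) = (\<Sum>k=1..K. if k = i then s t i else 0)"
      using assms(2,3) t by (intro sum.cong) (auto simp: comp)
    then show "s t i = (\<Sum>k=1..K. min (comparator opt (vol t) k) (s t k))"
      using assms(1) by (simp add: sum.delta)
  qed
  also have "\<dots> \<le> comparator_reward K V T vol s"
    unfolding comparator_reward_def using opt
    by (intro Max_ge) (auto simp: finite_PiE intro!: finite_imageI)
  finally show ?thesis .
qed

text \<open>Feasible allocations are nonnegative, so each consumed amount lies between 0 and
  \<open>s t i\<close> and is integrable; the comparator's reward is constant in
  \<open>A\<close>.\<close>

lemma expected_regret_eq:
  assumes \<mu>: "randomized_algorithm K V T \<mu>" and adv: "adversary_choice K V T vol s" and "K \<ge> 1"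
  shows "integrable \<mu> (\<lambda>A. learner_reward K T A vol s)"
    and "expected_regret K V T \<mu> vol s =
      comparator_reward K V T vol s - (\<integral>A. learner_reward K T A vol s \<partial>\<mu>)"
proof -
  interpret prob_space \<mu> using \<mu> by (simp add: randomized_algorithm_def)
  have meas: "(\<lambda>A. allocation K A vol s t i) \<in> borel_measurable \<mu>"
    if "t \<in> {1..T}" "i \<in> {1..K}" for t i
    using \<mu> adv that by (auto simp: randomized_algorithm_def)
  have "AE A in \<mu>. norm (min (allocation K A vol s t i) (s t i)) \<le> s t i"
    if "t \<in> {1..T}" "i \<in> {1..K}" for t i
    using \<mu> adv that
    by (intro AE_I2) (auto simp: randomized_algorithm_def feasible_algorithm_def adversary_choice_def)
  then have "integrable \<mu> (\<lambda>A. min (allocation K A vol s t i) (s t i))"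
    if "t \<in> {1..T}" "i \<in> {1..K}" for t i
    using that meas by (intro integrable_const_bound[where B = "s t i"] borel_measurable_min) auto
  then show int: "integrable \<mu> (\<lambda>A. learner_reward K T A vol s)"
    unfolding learner_reward_def by (intro Bochner_Integration.integrable_sum)
  show "expected_regret K V T \<mu> vol s =
      comparator_reward K V T vol s - (\<integral>A. learner_reward K T A vol s \<partial>\<mu>)"
    unfolding expected_regret_def using int assms(3) by (simp add: regret_eq prob_space)
qed

section \<open>The adversary\<close>

text \<open>Rounds and venues start at 1 while residues and bit positions start at 0, hence the
  shifts. An open venue has level \<open>V\<close>, which no feasible allocation exceeds.\<close>

definition adversary :: "nat \<Rightarrow> nat \<Rightarrow> nat set \<Rightarrow> nat \<Rightarrow> nat \<Rightarrow> real" where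
  "adversary V m X t i = (if t \<in> X \<longleftrightarrow> bit (i - 1) ((t - 1) mod m) then real V else 0)"

lemma adversary_choice_adversary: "V \<ge> 1 \<Longrightarrow> adversary_choice K V T (\<lambda>_. V) (adversary V m X)"
  by (auto simp: adversary_choice_def adversary_def)

text \<open>Sign patterns are paired by flipping round \<open>t\<close>. The allocation of round
  \<open>t\<close> is the same in both, and each venue is open in exactly one, so a pair yields at
  most the allocated total, hence at most \<open>V\<close>.\<close>

lemma sum_learner_reward_le:
  assumes A: "feasible_algorithm K V T A" and "V \<ge> 1"
  shows "(\<Sum>X\<in>Pow {1..T}. learner_reward K T A (\<lambda>_. V) (adversary V m X)) \<le> 2 ^ T * (V / 2 * T)"
proof -
  define f where "f X t = (\<Sum>i=1..K. min (allocation K A (\<lambda>_. V) (adversary V m X) t i) (adversary V m X t i))"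
    for X t
  have feas: "\<And>i. i \<in> {1..K} \<Longrightarrow> 0 \<le> allocation K A (\<lambda>_. V) (adversary V m X) t i"
    "(\<Sum>i=1..K. allocation K A (\<lambda>_. V) (adversary V m X) t i) \<le> V" if "t \<in> {1..T}" for X t
    using A[unfolded feasible_algorithm_def, rule_format,
        OF adversary_choice_adversary[OF assms(2)] that] by auto
  have "(\<Sum>X\<in>Pow {1..T}. f X t) \<le> 2 ^ T * (V / 2)" if t: "t \<in> {1..T}" for t
  proof -
    define F where "F = {1..T} - {t}"
    have F: "finite F" "t \<notin> F" "insert t F = {1..T}" using t by (auto simp: F_def)
    have pair: "f X t + f (insert t X) t \<le> V" if X: "X \<in> Pow F" for X
    proof -
      let ?a = "allocation K A (\<lambda>_. V) (adversary V m X) t"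
      have eq: "allocation K A (\<lambda>_. V) (adversary V m (insert t X)) t = ?a"
        by (intro allocation_cong) (auto simp: adversary_def)
      have "t \<notin> X" using X F(2) by auto
      have "f X t + f (insert t X) t =
          (\<Sum>i=1..K. min (?a i) (adversary V m X t i) + min (?a i) (adversary V m (insert t X) t i))"
        unfolding f_def eq by (simp add: sum.distrib)
      also have "\<dots> \<le> (\<Sum>i=1..K. ?a i)"
        using feas(1)[OF t] \<open>t \<notin> X\<close> by (intro sum_mono) (auto simp: adversary_def)
      also have "\<dots> \<le> V" using feas(2)[OF t] .
      finally show ?thesis .
    qed
    have "(\<Sum>X\<in>Pow {1..T}. f X t) = (\<Sum>X\<in>Pow F. f X t + f (insert t X) t)"
      using sum_Pow_insert[OF F(1,2), of "\<lambda>X. f X t"] F(3) by simp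
    also have "\<dots> \<le> (\<Sum>X\<in>Pow F. V)"
      unfolding of_nat_sum by (intro sum_mono pair)
    also have "\<dots> = 2 ^ card F * V" using F(1) by (simp add: card_Pow)
    \<comment> \<open>\<open>F\<close> omits one round, so there are \<open>2 ^ (T - 1)\<close>
      pairs; this is the source of the factor 1/2.\<close>
    also have "\<dots> = 2 ^ T * (V / 2)"
      using t by (cases T) (auto simp: F_def)
    finally show ?thesis by simp
  qed
  then have "(\<Sum>t=1..T. \<Sum>X\<in>Pow {1..T}. f X t) \<le> (\<Sum>t=1..T. 2 ^ T * (V / 2))"
    by (intro sum_mono) auto
  then show ?thesis
    unfolding learner_reward_def f_def[symmetric] by (subst sum.swap) (simp add: algebra_simps)
qed

section \<open>Residue classes of rounds and the best venue in hindsight\<close>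

definition residue_class :: "nat \<Rightarrow> nat \<Rightarrow> nat \<Rightarrow> nat set" where
  "residue_class T m j = {t \<in> {1..T}. (t - 1) mod m = j}"

lemma card_residue_class_ge:
  assumes "j < m"
  shows "T div m \<le> card (residue_class T m j)"
proof -
  \<comment> \<open>One round of class \<open>j\<close> from each complete block of \<open>m\<close>
    consecutive rounds.\<close>
  have "inj_on (\<lambda>k. k * m + j + 1) {..<T div m}"
    using assms by (auto simp: inj_on_def)
  then have "T div m = card ((\<lambda>k. k * m + j + 1) ` {..<T div m})"
    by (simp add: card_image)
  also have "\<dots> \<le> card (residue_class T m j)"
  proof (intro card_mono)
    show "finite (residue_class T m j)" by (simp add: residue_class_def)
    show "(\<lambda>k. k * m + j + 1) ` {..<T div m} \<subseteq> residue_class T m j"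
    proof (clarsimp simp: residue_class_def assms)
      fix k assume "k < T div m"
      then have "Suc k * m \<le> T div m * m" by (intro mult_right_mono) auto
      also have "\<dots> \<le> T" by simp
      finally show "Suc (k * m + j) \<le> T" using assms by simp
    qed
  qed
  finally show ?thesis .
qed

lemma comparator_reward_adversary_ge:
  assumes "m \<ge> 1" "2 ^ m \<le> K" "V \<ge> 1"
  shows "V / 2 * (T + (\<Sum>j<m. \<bar>\<Sum>t\<in>residue_class T m j. sign_in X t\<bar>))
    \<le> comparator_reward K V T (\<lambda>_. V) (adversary V m X)"
proof -
  define S where "S j = (\<Sum>t\<in>residue_class T m j. sign_in X t)" for j
  \<comment> \<open>Bit \<open>j\<close> of \<open>n\<close> follows the majority sign of class
    \<open>j\<close>; the venue is \<open>n + 1\<close>.\<close>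
  obtain n :: nat where n: "n < 2 ^ m" "\<And>j. j < m \<Longrightarrow> bit n j \<longleftrightarrow> S j \<ge> 0"
    using ex_nat_with_bits[of m "\<lambda>j. S j \<ge> 0"] by auto
  define b where "b j = (if S j \<ge> 0 then 1 else - 1 :: real)" for j
  have adv: "adversary V m X t (n + 1) = V / 2 * (1 + b ((t - 1) mod m) * sign_in X t)" for t
    using n(2)[of "(t - 1) mod m"] assms(1) by (auto simp: adversary_def b_def sign_in_def)
  have "(\<Sum>j<m. \<bar>S j\<bar>) = (\<Sum>j<m. \<Sum>t\<in>residue_class T m j. b ((t - 1) mod m) * sign_in X t)"
  proof (intro sum.cong refl)
    fix j
    have "\<bar>S j\<bar> = b j * S j" by (simp add: b_def)
    also have "\<dots> = (\<Sum>t\<in>residue_class T m j. b ((t - 1) mod m) * sign_in X t)"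
      unfolding S_def sum_distrib_left by (intro sum.cong) (auto simp: residue_class_def)
    finally show "\<bar>S j\<bar> = (\<Sum>t\<in>residue_class T m j. b ((t - 1) mod m) * sign_in X t)" .
  qed
  \<comment> \<open>The residue classes partition the rounds.\<close>
  also have "\<dots> = (\<Sum>t=1..T. b ((t - 1) mod m) * sign_in X t)"
    unfolding residue_class_def using assms(1) by (intro sum.group) auto
  finally have "V / 2 * (T + (\<Sum>j<m. \<bar>S j\<bar>)) = (\<Sum>t=1..T. adversary V m X t (n + 1))"
    unfolding adv sum_distrib_left[symmetric] by (simp add: sum.distrib)
  also have "\<dots> \<le> comparator_reward K V T (\<lambda>_. V) (adversary V m X)"
    using n(1) assms by (intro comparator_reward_ge_single_venue) (auto simp: adversary_def)
  finally show ?thesis by (simp add: S_def)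
qed

section \<open>Averaging over sign patterns and choice of constants\<close>

lemma ex_adversary_expected_regret_ge:
  assumes \<mu>: "randomized_algorithm K V T \<mu>" and m: "m \<ge> 1" "2 ^ m \<le> K" and V: "V \<ge> 1"
  shows "\<exists>X. expected_regret K V T \<mu> (\<lambda>_. V) (adversary V m X) \<ge> V / 2 * (m * sqrt (real (T div m) / 3))"
proof (rule ccontr)
  interpret prob_space \<mu> using \<mu> by (simp add: randomized_algorithm_def)
  let ?R = "\<lambda>X. expected_regret K V T \<mu> (\<lambda>_. V) (adversary V m X)"
  let ?L = "\<lambda>X A. learner_reward K T A (\<lambda>_. V) (adversary V m X)"
  let ?C = "\<lambda>X. comparator_reward K V T (\<lambda>_. V) (adversary V m X)"
  let ?S = "\<lambda>X j. \<bar>\<Sum>t\<in>residue_class T m j. sign_in X t\<bar>"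
  let ?r = "V / 2 * (m * sqrt (real (T div m) / 3))"
  have K: "K \<ge> 1" using m(2) by (metis one_le_numeral one_le_power order_trans)
  note eq = expected_regret_eq[OF \<mu> adversary_choice_adversary[OF V] K]
  \<comment> \<open>Probabilistic method: if every pattern gave regret below \<open>?r\<close>, so
    would the average over \<open>Pow {1..T}\<close>.\<close>
  assume "\<not> (\<exists>X. ?R X \<ge> ?r)"
  then have "(\<Sum>X\<in>Pow {1..T}. ?R X) < (\<Sum>X\<in>Pow {1..T}. ?r)"
    by (intro sum_strict_mono) (auto simp: not_le)
  then have upper: "(\<Sum>X\<in>Pow {1..T}. ?R X) < 2 ^ T * ?r"
    by (simp add: card_Pow)
  \<comment> \<open>Exchanging the average with the integral reduces the randomized learner to the
    bound for each deterministic \<open>A\<close>.\<close>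
  have "(\<Sum>X\<in>Pow {1..T}. \<integral>A. ?L X A \<partial>\<mu>) = (\<integral>A. (\<Sum>X\<in>Pow {1..T}. ?L X A) \<partial>\<mu>)"
    using eq(1) by (intro Bochner_Integration.integral_sum[symmetric]) auto
  also have "\<dots> \<le> (\<integral>A. 2 ^ T * (V / 2 * T) \<partial>\<mu>)"
    using \<mu> V by (intro integral_mono sum_learner_reward_le Bochner_Integration.integrable_sum eq(1))
      (auto simp: randomized_algorithm_def)
  finally have learner: "(\<Sum>X\<in>Pow {1..T}. \<integral>A. ?L X A \<partial>\<mu>) \<le> 2 ^ T * (V / 2 * T)"
    by (simp add: prob_space)
  have residue: "residue_class T m j \<subseteq> {1..T}" for j
    by (auto simp: residue_class_def)
  have "2 ^ T * (m * sqrt (real (T div m) / 3)) = (\<Sum>j<m. 2 ^ T * sqrt (real (T div m) / 3))"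
    by simp
  also have "\<dots> \<le> (\<Sum>j<m. \<Sum>X\<in>Pow {1..T}. ?S X j)"
  proof (intro sum_mono)
    fix j assume "j \<in> {..<m}"
    then have "2 ^ T * sqrt (real (T div m) / 3) \<le> 2 ^ T * sqrt (card (residue_class T m j) / 3)"
      using card_residue_class_ge[of j m T] by auto
    also have "\<dots> \<le> (\<Sum>X\<in>Pow {1..T}. ?S X j)"
      using khintchine_lower_bound_subset[OF finite_atLeastAtMost residue[of j]] by simp
    finally show "2 ^ T * sqrt (real (T div m) / 3) \<le> (\<Sum>X\<in>Pow {1..T}. ?S X j)" .
  qed
  finally have "V / 2 * (2 ^ T * T + 2 ^ T * (m * sqrt (real (T div m) / 3)))
      \<le> V / 2 * (2 ^ T * T + (\<Sum>j<m. \<Sum>X\<in>Pow {1..T}. ?S X j))"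
    by (intro mult_left_mono add_left_mono) auto
  also have "\<dots> = (\<Sum>X\<in>Pow {1..T}. V / 2 * (T + (\<Sum>j<m. ?S X j)))"
    unfolding sum_distrib_left[symmetric] by (subst sum.swap) (simp add: sum.distrib card_Pow)
  also have "\<dots> \<le> (\<Sum>X\<in>Pow {1..T}. ?C X)"
    by (intro sum_mono comparator_reward_adversary_ge m V)
  finally have "2 ^ T * ?r \<le> (\<Sum>X\<in>Pow {1..T}. ?R X)"
    using learner by (simp add: eq(2) sum_subtractf algebra_simps)
  with upper show False by simp
qed

theorem mainTheorem2:
  "\<exists>c::real. c > 0 \<and>
     (\<forall>K V :: nat. 2 \<le> K \<longrightarrow> 1 \<le> V \<longrightarrow>
       (\<exists>T\<^sub>0 :: nat. \<forall>T\<ge>T\<^sub>0. \<forall>\<mu>. randomized_algorithm K V T \<mu> \<longrightarrow>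
          (\<exists>vol s. adversary_choice K V T vol s \<and>
             expected_regret K V T \<mu> vol s \<ge> c * real V * sqrt (real T * ln (real K)))))"
\<comment> \<open>The constant is 1/2 from the bound
  \<open>V / 2 * (m * sqrt (real (T div m) / 3))\<close> times 1/4 from comparing its second factor
  with \<open>sqrt (T * ln K)\<close>.\<close>
proof (intro exI[of _ "1 / 8"] conjI allI impI)
  fix K V :: nat
  assume K: "2 \<le> K" and V: "1 \<le> V"
  define m where "m = floor_log K"
  have "m = Suc (floor_log (K div 2))"
    unfolding m_def by (rule floor_log_rec[OF K])
  then have m: "m \<ge> 1" "2 ^ m \<le> K" "K < 2 ^ (m + 1)"
    using K floor_log_exp2_le[of K] floor_log_exp2_gt[of K] by (simp_all flip: m_def)
  have "real K \<le> real (2 ^ (m + 1))"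
    using m(3) by (subst of_nat_le_iff) simp
  then have "ln (real K) \<le> ln (2 ^ (m + 1))"
    using K by (subst ln_le_cancel_iff) auto
  also have "\<dots> = (m + 1) * ln 2" by (subst ln_realpow) auto
  also have "\<dots> \<le> real (m + 1) * 1" using ln_2_less_1 by (intro mult_left_mono) auto
  finally have lnK: "ln (real K) \<le> 2 * m" using m(1) by simp
  show "\<exists>T\<^sub>0. \<forall>T\<ge>T\<^sub>0. \<forall>\<mu>. randomized_algorithm K V T \<mu> \<longrightarrow>
      (\<exists>vol s. adversary_choice K V T vol s \<and>
         expected_regret K V T \<mu> vol s \<ge> 1 / 8 * real V * sqrt (real T * ln (real K)))"
  \<comment> \<open>From \<open>T = m\<close> on there is at least one complete block, so rounding
    \<open>T / m\<close> down loses at most a factor 2.\<close>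
  proof (intro exI[of _ m] allI impI)
    fix T \<mu> assume T: "m \<le> T" and \<mu>: "randomized_algorithm K V T \<mu>"
    obtain X where X: "V / 2 * (m * sqrt (real (T div m) / 3))
        \<le> expected_regret K V T \<mu> (\<lambda>_. V) (adversary V m X)"
      using ex_adversary_expected_regret_ge[OF \<mu> m(1,2) V] by auto
    have "T div m \<ge> 1" using T m(1) by (simp add: div_greater_zero_iff Suc_le_eq)
    then have "m * 1 \<le> m * (T div m)" by (intro mult_left_mono) auto
    moreover have "T = m * (T div m) + T mod m" "T mod m < m" using m(1) by auto
    ultimately have "T \<le> 2 * (m * (T div m))" by linarith
    then have T_le: "real T \<le> 2 * (m * real (T div m))"
      by (metis of_nat_le_iff of_nat_mult of_nat_numeral)
    have "real T * ln (real K) \<le> 2 * (m * real (T div m)) * (2 * m)"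
      using T_le lnK K by (intro mult_mono) auto
    \<comment> \<open>With \<open>q = T div m\<close> this reads
      \<open>4 * m\<^sup>2 * q \<le> 16 / 3 * m\<^sup>2 * q\<close>, which is why the factor 4
      suffices.\<close>
    also have "\<dots> \<le> (4 * (m * sqrt (real (T div m) / 3)))\<^sup>2"
      by (simp add: power_mult_distrib power2_eq_square)
    finally have "sqrt (real T * ln (real K)) \<le> 4 * (m * sqrt (real (T div m) / 3))"
      by (intro real_le_lsqrt) auto
    then have "1 / 8 * real V * sqrt (real T * ln (real K))
        \<le> 1 / 8 * real V * (4 * (m * sqrt (real (T div m) / 3)))"
      by (intro mult_left_mono) auto
    also have "\<dots> = V / 2 * (m * sqrt (real (T div m) / 3))" by simp
    also note X
    finally show "\<exists>vol s. adversary_choice K V T vol s \<and>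
        expected_regret K V T \<mu> vol s \<ge> 1 / 8 * real V * sqrt (real T * ln (real K))"
      using adversary_choice_adversary[OF V] by blast
  qed
qed simp

end
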